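(* Let $x^*\in\{0,\pm1\}^d$, $S:=\operatorname{supp}(x^* )$, and assume $|S|=\sigma$. Define $y^*:=-M^\top b/n$ and $Y_{11}^*:=-(y_S^* )^\top x_S^*$, and assume $Y_{11}^*>0$. Then (SILS'-SDP) recovers $x^*$ if there exists a constant $\delta>0$ such that, with $$\mu_3^*:=\frac1\sigma\Big\{\lambda_{\min}\Big(\frac1n(M^\top M)_{S,S}\Big)-\delta+\min_{i\in S}\Big[-y_S^*-\frac1n(M^\top M)_{S,S}x_S^*\Big]_i\big/x_i^*\Big\},$$ the following two conditions are satisfied: (A1) $\Big\|\frac1{n\sigma}(M^\top M)_{S^c,S}x_S^*+\frac1\sigma y^*_{S^c}\Big\|_\infty\le\mu_3^*$; (A2) there exists $\mu_2^*\le-\lambda_{\min}\big(\frac1n(M^\top M)_{S,S}\big)+\delta$ such that the matrix $$\Theta:=\frac1n(M^\top M)_{S^c,S^c}+\mu_2^*I_{d-\sigma}-\frac1{Y_{11}^*}y^*_{S^c}(y^*_{S^c})^\top-R\,\frac1\delta\Big(I_\sigma-\frac1\sigma x_S^*(x_S^* )^\top\Big)R^\top,\qquad R:=\frac1n(M^\top M)_{S^c,S}-\frac1{Y_{11}^*}y^*_{S^c}(y^*_S)^\top,$$ can be written as a sum $\Theta=\Theta_1+\Theta_2$ with either $\Theta_1\succ0$ and $\|\Theta_2\|_\infty\le\mu_3^*$, or $\Theta_1\succeq0$ and $\|\Theta_2\|_\infty<\mu_3^*$.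
   Context: $n,d,\sigma$ are positive integers with $\sigma\le d$, $M\in\mathbb{R}^{n\times d}$, $b\in\mathbb{R}^n$, and $A:=\begin{pmatrix}-b&M\end{pmatrix}\in\mathbb{R}^{n\times(1+d)}$. (SILS'-SDP): minimize $\frac1n\operatorname{tr}(A^\top AW)$ over symmetric positive semidefinite $W\in\mathbb{R}^{(1+d)\times(1+d)}$ subject to $W_{11}=1$, $\operatorname{tr}(W_x)=\sigma$, $1_d^\top|W_x|1_d\le\sigma^2$, $\operatorname{diag}(W_x)\le1_d$ (entrywise), where $W_x$ is $W$ with first row and column deleted, $|W_x|$ is the entrywise absolute value, and $1_d$ is the all-ones vector. It is a relaxation of (SILS'): minimize $\frac1n\|Mx-b\|_2^2$ over $x\in\{0,\pm1\}^d$ with exactly $\sigma$ nonzero entries. "(SILS'-SDP) recovers $x^*$" means: $x^*\in\{0,\pm1\}^d$ and (SILS'-SDP) has a unique optimal solution, namely the rank-one matrix $W^*=\begin{pmatrix}1 \\ x^*\end{pmatrix}\begin{pmatrix}1 \\ x^*\end{pmatrix}^\top$. Notation: $\operatorname{supp}(x)=\{i:x_i\ne0\}$; $S^c=\{1,\dots,d\}\setminus S$; $v_I$ and $N_{I,J}$ denote the subvector and submatrix with the indicated indices; $\|\cdot\|_\infty$ is the largest absolute value of an entry of a vector or matrix ($0$ for an empty one); $\lambda_{\min}$ is the smallest eigenvalue; $\succ$, $\succeq$ denote positive (semi)definiteness of symmetric matrices. *)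

theory Defs
  imports "HOL-Analysis.Analysis"
begin

text \<open>
  The submatrix \<open>N\<^bsub>I,J\<^esub>\<close> of a matrix with rows indexed by \<open>'i\<close> and columns by \<open>'j\<close> is rendered as
  the entry function \<open>'i \<Rightarrow> 'j \<Rightarrow> real\<close> together with the index sets \<open>I\<close> and \<open>J\<close>; values outside
  \<open>I \<times> J\<close> never matter. Subvectors are treated in the same way.
\<close>

definition quad_form_on :: "'i set \<Rightarrow> ('i \<Rightarrow> 'i \<Rightarrow> real) \<Rightarrow> ('i \<Rightarrow> real) \<Rightarrow> real" where
  "quad_form_on I N v = (\<Sum>i\<in>I. \<Sum>j\<in>I. v i * N i j * v j)"

definition symmetric_on :: "'i set \<Rightarrow> ('i \<Rightarrow> 'i \<Rightarrow> real) \<Rightarrow> bool" where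
  "symmetric_on I N \<longleftrightarrow> (\<forall>i\<in>I. \<forall>j\<in>I. N i j = N j i)"

definition psd_on :: "'i set \<Rightarrow> ('i \<Rightarrow> 'i \<Rightarrow> real) \<Rightarrow> bool" where
  "psd_on I N \<longleftrightarrow> symmetric_on I N \<and> (\<forall>v. 0 \<le> quad_form_on I N v)"

definition pd_on :: "'i set \<Rightarrow> ('i \<Rightarrow> 'i \<Rightarrow> real) \<Rightarrow> bool" where
  "pd_on I N \<longleftrightarrow> symmetric_on I N \<and> (\<forall>v. (\<exists>i\<in>I. v i \<noteq> 0) \<longrightarrow> 0 < quad_form_on I N v)"

definition eigenvalue_on :: "'i set \<Rightarrow> ('i \<Rightarrow> 'i \<Rightarrow> real) \<Rightarrow> real \<Rightarrow> bool" where
  "eigenvalue_on I N l \<longleftrightarrow>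
     (\<exists>v. (\<exists>i\<in>I. v i \<noteq> 0) \<and> (\<forall>i\<in>I. (\<Sum>j\<in>I. N i j * v j) = l * v i))"

text \<open>Only meaningful for symmetric \<open>N\<close> and finite nonempty \<open>I\<close>, where a least eigenvalue exists.\<close>

definition lambda_min_on :: "'i set \<Rightarrow> ('i \<Rightarrow> 'i \<Rightarrow> real) \<Rightarrow> real" where
  "lambda_min_on I N = (LEAST l. eigenvalue_on I N l)"

text \<open>Inserting \<open>0\<close> only affects empty vectors and matrices, whose norm is \<open>0\<close>.\<close>

definition vec_max_norm_on :: "'i set \<Rightarrow> ('i \<Rightarrow> real) \<Rightarrow> real" where
  "vec_max_norm_on I v = Max (insert 0 ((\<lambda>i. \<bar>v i\<bar>) ` I))"

definition mat_max_norm_on :: "'i set \<Rightarrow> 'j set \<Rightarrow> ('i \<Rightarrow> 'j \<Rightarrow> real) \<Rightarrow> real" where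
  "mat_max_norm_on I J N = Max (insert 0 ((\<lambda>(i, j). \<bar>N i j\<bar>) ` (I \<times> J)))"

definition supp :: "real ^ 'd \<Rightarrow> 'd set" where
  "supp x = {i. x $ i \<noteq> 0}"

definition ternary :: "real ^ 'd \<Rightarrow> bool" where
  "ternary x \<longleftrightarrow> (\<forall>i. x $ i \<in> {0, 1, -1})"

text \<open>
  With \<open>d = CARD('d)\<close>, the \<open>1 + d\<close> indices are the elements of \<open>'d option\<close>; \<open>None\<close> is the first one.
\<close>

definition aug_matrix :: "real ^ 'd ^ 'n \<Rightarrow> real ^ 'n \<Rightarrow> real ^ ('d option) ^ 'n" where
  "aug_matrix M b = (\<chi> i j. case j of None \<Rightarrow> - (b $ i) | Some k \<Rightarrow> M $ i $ k)"

definition lower_block :: "real ^ ('d option) ^ ('d option) \<Rightarrow> real ^ 'd ^ 'd" where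
  "lower_block W = (\<chi> i j. W $ Some i $ Some j)"

definition sdp_objective ::
    "real ^ 'd ^ 'n \<Rightarrow> real ^ 'n \<Rightarrow> real ^ ('d::finite option) ^ ('d option) \<Rightarrow> real" where
  "sdp_objective M b W =
     1 / real CARD('n) * trace (transpose (aug_matrix M b) ** aug_matrix M b ** W)"

definition sdp_feasible :: "nat \<Rightarrow> real ^ ('d::finite option) ^ ('d option) \<Rightarrow> bool" where
  "sdp_feasible \<sigma> W \<longleftrightarrow>
     psd_on UNIV (\<lambda>i j. W $ i $ j) \<and>
     W $ None $ None = 1 \<and>
     trace (lower_block W) = real \<sigma> \<and>
     (\<Sum>i\<in>UNIV. \<Sum>j\<in>UNIV. \<bar>lower_block W $ i $ j\<bar>) \<le> (real \<sigma>)\<^sup>2 \<and>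
     (\<forall>i. lower_block W $ i $ i \<le> 1)"

definition sdp_optimal ::
    "real ^ 'd ^ 'n \<Rightarrow> real ^ 'n \<Rightarrow> nat \<Rightarrow> real ^ ('d::finite option) ^ ('d option) \<Rightarrow> bool" where
  "sdp_optimal M b \<sigma> W \<longleftrightarrow>
     sdp_feasible \<sigma> W \<and> (\<forall>V. sdp_feasible \<sigma> V \<longrightarrow> sdp_objective M b W \<le> sdp_objective M b V)"

definition homogenize :: "real ^ 'd \<Rightarrow> real ^ ('d option)" where
  "homogenize x = (\<chi> i. case i of None \<Rightarrow> 1 | Some k \<Rightarrow> x $ k)"

definition rank_one_lift :: "real ^ 'd \<Rightarrow> real ^ ('d option) ^ ('d option)" where
  "rank_one_lift x = (\<chi> i j. homogenize x $ i * homogenize x $ j)"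

definition sdp_recovers ::
    "real ^ 'd ^ 'n \<Rightarrow> real ^ 'n \<Rightarrow> nat \<Rightarrow> real ^ ('d::finite) \<Rightarrow> bool" where
  "sdp_recovers M b \<sigma> x \<longleftrightarrow> ternary x \<and> {W. sdp_optimal M b \<sigma> W} = {rank_one_lift x}"

definition gram :: "real ^ 'd ^ 'n \<Rightarrow> 'd \<Rightarrow> 'd \<Rightarrow> real" where
  "gram M i j = 1 / real CARD('n) * (transpose M ** M) $ i $ j"

definition y_star :: "real ^ 'd ^ 'n \<Rightarrow> real ^ 'n \<Rightarrow> real ^ 'd" where
  "y_star M b = - (1 / real CARD('n)) *\<^sub>R (transpose M *v b)"

definition Y11_star :: "real ^ 'd ^ 'n \<Rightarrow> real ^ 'n \<Rightarrow> real ^ 'd \<Rightarrow> real" where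
  "Y11_star M b x = - (\<Sum>i\<in>supp x. y_star M b $ i * x $ i)"

definition mu3_star ::
    "real ^ 'd ^ 'n \<Rightarrow> real ^ 'n \<Rightarrow> nat \<Rightarrow> real ^ 'd \<Rightarrow> real \<Rightarrow> real" where
  "mu3_star M b \<sigma> x \<delta> =
     1 / real \<sigma> *
       (lambda_min_on (supp x) (gram M) - \<delta>
        + Min ((\<lambda>i. (- y_star M b $ i - (\<Sum>j\<in>supp x. gram M i j * x $ j)) / x $ i) ` supp x))"

text \<open>Used for rows \<open>i\<close> outside the support of \<open>x\<close> and columns \<open>k\<close> inside it.\<close>

definition R_block ::
    "real ^ 'd ^ 'n \<Rightarrow> real ^ 'n \<Rightarrow> real ^ 'd \<Rightarrow> 'd \<Rightarrow> 'd \<Rightarrow> real" where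
  "R_block M b x i k = gram M i k - 1 / Y11_star M b x * (y_star M b $ i * y_star M b $ k)"

text \<open>Used for row and column indices outside the support of \<open>x\<close>.\<close>

definition Theta ::
    "real ^ 'd ^ 'n \<Rightarrow> real ^ 'n \<Rightarrow> nat \<Rightarrow> real ^ 'd \<Rightarrow> real \<Rightarrow> real \<Rightarrow> 'd \<Rightarrow> 'd \<Rightarrow> real" where
  "Theta M b \<sigma> x \<delta> \<mu>\<^sub>2 i j =
     gram M i j + \<mu>\<^sub>2 * (if i = j then 1 else 0)
     - 1 / Y11_star M b x * (y_star M b $ i * y_star M b $ j)
     - (\<Sum>k\<in>supp x. \<Sum>l\<in>supp x.
          R_block M b x i k
          * (1 / \<delta> * ((if k = l then 1 else 0) - 1 / real \<sigma> * (x $ k * x $ l)))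
          * R_block M b x j l)"

end

theory Submission
  imports Defs
begin

text \<open>
  The proof is by an explicit dual certificate. Multipliers for the diagonal, trace and 1-norm
  constraints give a dual slack matrix with blocks \<open>Y11\<close>, \<open>y\<close>, \<open>D\<close> whose kernel contains \<open>(1, x)\<close>.
  Its quadratic form is thus invariant under translation by \<open>(1, x)\<close>, which allows one to assume
  that the support part \<open>v\<^sub>S\<close> of the argument is orthogonal to \<open>y\<^sub>S\<close>; completing squares there leaves the form of
  \<open>\<Theta>\<^sub>1\<close>. So the slack matrix is positive semidefinite and \<open>x\<close> is optimal. For uniqueness, write a
  feasible matrix as a sum of \<open>u u\<^sup>T\<close>: complementary slackness forces each \<open>u\<close> into the kernel of
  the slack matrix and, by definiteness of \<open>\<Theta>\<^sub>1\<close> or by strictness of the bound on \<open>\<Theta>\<^sub>2\<close>, makes it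
  vanish off the support, so that \<open>u\<close> is a multiple of \<open>(1, x)\<close>.
\<close>

subsection \<open>Quadratic forms and positive semidefinite matrices\<close>

lemma sum_UNIV_option:
  fixes f :: "'a::finite option \<Rightarrow> 'b::comm_monoid_add"
  shows "sum f UNIV = f None + (\<Sum>i\<in>UNIV. f (Some i))"
  by (simp add: UNIV_option_conv sum.reindex)

lemma quad_form_on_cong:
  assumes "\<And>i j. i \<in> I \<Longrightarrow> j \<in> I \<Longrightarrow> N i j = N' i j" and "\<And>i. i \<in> I \<Longrightarrow> v i = v' i"
  shows "quad_form_on I N v = quad_form_on I N' v'"
  unfolding quad_form_on_def using assms by (intro sum.cong) auto

lemma quad_form_on_add:
  assumes "symmetric_on I N"
  shows "quad_form_on I N (\<lambda>i. v i + t * w i)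
    = quad_form_on I N v + 2 * t * (\<Sum>i\<in>I. w i * (\<Sum>j\<in>I. N i j * v j)) + t\<^sup>2 * quad_form_on I N w"
proof -
  have swap: "(\<Sum>i\<in>I. \<Sum>j\<in>I. v i * N i j * w j) = (\<Sum>i\<in>I. w i * (\<Sum>j\<in>I. N i j * v j))"
    using assms unfolding symmetric_on_def sum_distrib_left
    by (subst sum.swap) (intro sum.cong, auto simp: mult_ac)
  have "quad_form_on I N (\<lambda>i. v i + t * w i)
      = quad_form_on I N v + t * (\<Sum>i\<in>I. \<Sum>j\<in>I. v i * N i j * w j)
        + t * (\<Sum>i\<in>I. w i * (\<Sum>j\<in>I. N i j * v j)) + t\<^sup>2 * quad_form_on I N w"
    unfolding quad_form_on_def sum_distrib_left sum.distrib[symmetric]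
    by (intro sum.cong refl) (simp add: algebra_simps power2_eq_square)
  with swap show ?thesis by simp
qed

lemma quad_form_on_Un:
  assumes "finite I" and "finite J" and "I \<inter> J = {}" and "symmetric_on (I \<union> J) N"
  shows "quad_form_on (I \<union> J) N v
    = quad_form_on I N v + 2 * (\<Sum>i\<in>J. \<Sum>j\<in>I. v i * N i j * v j) + quad_form_on J N v"
proof -
  have "(\<Sum>i\<in>I. \<Sum>j\<in>J. v i * N i j * v j) = (\<Sum>i\<in>J. \<Sum>j\<in>I. v i * N i j * v j)"
    using assms(4) unfolding symmetric_on_def
    by (subst sum.swap) (intro sum.cong, auto simp: mult_ac)
  then show ?thesis
    unfolding quad_form_on_def using assms(1-3) by (simp add: sum.union_disjoint sum.distrib)
qed

lemma pd_on_imp_psd_on: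
  assumes "pd_on I N"
  shows "psd_on I N"
  unfolding psd_on_def
proof (intro conjI allI)
  show "symmetric_on I N" using assms by (simp add: pd_on_def)
  show "0 \<le> quad_form_on I N v" for v
  proof (cases "\<exists>i\<in>I. v i \<noteq> 0")
    case True
    then show ?thesis using assms by (auto simp: pd_on_def intro: less_imp_le)
  next
    case False
    then show ?thesis by (simp add: quad_form_on_def)
  qed
qed

section \<open>Isotropic vectors and factorization of semidefinite matrices\<close>

lemma linear_coeff_eq_0:
  fixes p q :: real
  assumes "\<And>t. 0 \<le> 2 * t * p + t\<^sup>2 * q"
  shows "p = 0"
proof (rule ccontr)
  assume "p \<noteq> 0"
  \<comment> \<open>With this \<open>t\<close> the right-hand side is at most
    \<open>- t\<^sup>2 * (\<bar>q\<bar> + 2)\<close>, hence negative; the \<open>+ 1\<close> keeps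
    the denominator nonzero.\<close>
  define t where "t = - p / (\<bar>q\<bar> + 1)"
  have "(\<bar>q\<bar> + 1) * t = - p" by (simp add: t_def)
  then have p: "p = - ((\<bar>q\<bar> + 1) * t)" by simp
  have "2 * t * p = - 2 * (t\<^sup>2 * \<bar>q\<bar>) - 2 * t\<^sup>2"
    by (subst p) (simp add: power2_eq_square algebra_simps)
  moreover have "t\<^sup>2 * q \<le> t\<^sup>2 * \<bar>q\<bar>" by (intro mult_left_mono) auto
  moreover have "t\<^sup>2 > 0" using \<open>p \<noteq> 0\<close> by (simp add: t_def)
  moreover have "0 \<le> t\<^sup>2 * \<bar>q\<bar>" by simp
  ultimately show False using assms[of t] by linarith
qed

text \<open>A vector at which the form vanishes minimises it, so the first-order term vanishes in
  every direction; the unit vector at \<open>i\<close> picks out one entry of the product.\<close>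

lemma psd_on_kernel:
  assumes "finite I" and "psd_on I N" and "quad_form_on I N v = 0" and "i \<in> I"
  shows "(\<Sum>j\<in>I. N i j * v j) = 0"
proof (rule linear_coeff_eq_0)
  fix t :: real
  define e where "e = (\<lambda>k. if k = i then 1 else 0 :: real)"
  have "0 \<le> quad_form_on I N (\<lambda>k. v k + t * e k)"
    using assms(2) by (simp add: psd_on_def)
  also have "\<dots> = 2 * t * (\<Sum>k\<in>I. e k * (\<Sum>j\<in>I. N k j * v j)) + t\<^sup>2 * quad_form_on I N e"
    using assms(2,3) by (subst quad_form_on_add) (auto simp: psd_on_def)
  also have "(\<Sum>k\<in>I. e k * (\<Sum>j\<in>I. N k j * v j)) = (\<Sum>j\<in>I. N i j * v j)"
    using assms(1,4) by (simp add: e_def if_distrib[of "\<lambda>x. x * _"] cong: if_cong)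
  finally show "0 \<le> 2 * t * (\<Sum>j\<in>I. N i j * v j) + t\<^sup>2 * quad_form_on I N e" .
qed

lemma quad_form_on_insert:
  assumes "finite I" and "a \<notin> I" and "symmetric_on (insert a I) N"
  shows "quad_form_on (insert a I) N v
    = quad_form_on I N v + 2 * v a * (\<Sum>j\<in>I. N a j * v j) + N a a * (v a)\<^sup>2"
proof -
  have "quad_form_on (I \<union> {a}) N v
    = quad_form_on I N v + 2 * (\<Sum>i\<in>{a}. \<Sum>j\<in>I. v i * N i j * v j) + quad_form_on {a} N v"
    using assms by (intro quad_form_on_Un) auto
  then show ?thesis
    by (simp add: quad_form_on_def sum_distrib_left power2_eq_square mult_ac)
qed

lemma quad_form_on_unit:
  assumes "finite I" and "a \<in> I"
  shows "quad_form_on I N (\<lambda>k. if k = a then 1 else 0) = N a a"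
proof -
  have "quad_form_on I N (\<lambda>k. if k = a then 1 else 0)
    = (\<Sum>i\<in>I. if i = a then \<Sum>j\<in>I. if j = a then N i j else 0 else 0)"
    unfolding quad_form_on_def by (auto intro!: sum.cong)
  then show ?thesis using assms by simp
qed

lemma psd_on_diag_nonneg:
  assumes "finite I" and "psd_on I N" and "i \<in> I"
  shows "0 \<le> N i i"
  using assms quad_form_on_unit[of I i N] unfolding psd_on_def by metis

text \<open>Cholesky factorization: each step splits off one vector and passes to the Schur complement.\<close>

lemma psd_on_decomposition:
  assumes "finite I" and "psd_on I N"
  shows "\<exists>u. \<forall>i\<in>I. \<forall>j\<in>I. N i j = (\<Sum>k\<in>I. u k i * u k j :: real)"
  using assms
proof (induction I arbitrary: N rule: finite_induct)
  case empty
  then show ?case by simp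
next
  case (insert a I)
  have sym: "symmetric_on (insert a I) N" and nonneg: "\<And>v. 0 \<le> quad_form_on (insert a I) N v"
    using insert.prems by (auto simp: psd_on_def)
  have split: "quad_form_on (insert a I) N v
      = quad_form_on I N v + 2 * v a * (\<Sum>j\<in>I. N a j * v j) + N a a * (v a)\<^sup>2" for v
    using insert.hyps sym by (rule quad_form_on_insert)
  have symI: "symmetric_on I N"
    using sym by (auto simp: symmetric_on_def)
  have comm: "N j a = N a j" if "j \<in> I" for j
    using sym that unfolding symmetric_on_def by blast
  have "0 \<le> N a a" using insert.hyps insert.prems by (intro psd_on_diag_nonneg[of "insert a I"]) auto
  \<comment> \<open>The column of the Cholesky factor that belongs to the pivot \<open>a\<close>; a
    zero pivot gets the zero column, because its whole row vanishes.\<close>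
  define w where "w = (\<lambda>j. if N a a = 0 then 0 else N a j / sqrt (N a a))"
  have row: "N a j = w a * w j" if "j \<in> insert a I" for j
  proof (cases "N a a = 0")
    case True
    \<comment> \<open>For a zero pivot the unit vector at \<open>a\<close> is isotropic, hence in
      the kernel.\<close>
    have "quad_form_on (insert a I) N (\<lambda>k. if k = a then 1 else 0) = 0"
      using insert.hyps True by (simp add: quad_form_on_unit)
    then have "(\<Sum>k\<in>insert a I. N j k * (if k = a then 1 else 0)) = 0"
      using insert.hyps insert.prems that by (intro psd_on_kernel) auto
    then have "N j a = 0"
      using insert.hyps by (simp add: if_distrib[of "\<lambda>x. _ * x"] cong: if_cong)
    then show ?thesis using comm that True by (auto simp: w_def)
  next
    case False
    then show ?thesis using \<open>0 \<le> N a a\<close> by (simp add: w_def)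
  qed
  have "psd_on I (\<lambda>i j. N i j - w i * w j)"
    unfolding psd_on_def
  proof (intro conjI allI)
    show "symmetric_on I (\<lambda>i j. N i j - w i * w j)"
      using symI unfolding symmetric_on_def by (metis mult.commute)
  next
    fix v
    define s where "s = (\<Sum>j\<in>I. w j * v j)"
    \<comment> \<open>The new entry at \<open>a\<close> minimises the form of \<open>N\<close> in
      that coordinate, and the minimum is the form of the Schur complement. If
      \<open>w a = 0\<close>, then \<open>s = 0\<close> and any entry would do.\<close>
    define v' where "v' = v(a := if w a = 0 then 0 else - s / w a)"
    have "quad_form_on I (\<lambda>i j. N i j - w i * w j) v = quad_form_on I N v - s * s"
      unfolding quad_form_on_def s_def sum_product sum_subtractf[symmetric]
      by (intro sum.cong refl) (simp add: algebra_simps)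
    moreover have "quad_form_on (insert a I) N v' = quad_form_on I N v - s * s"
    proof -
      have "quad_form_on I N v' = quad_form_on I N v"
        using insert.hyps by (intro quad_form_on_cong) (auto simp: v'_def)
      moreover have "(\<Sum>j\<in>I. N a j * v' j) = w a * s"
        unfolding s_def sum_distrib_left using insert.hyps row
        by (intro sum.cong) (auto simp: v'_def)
      moreover have "N a a = w a * w a" using row by simp
      moreover have "s = 0" if "w a = 0"
      proof -
        have "N a a = 0" using that row[of a] by simp
        then show ?thesis by (simp add: s_def w_def)
      qed
      ultimately show ?thesis
        unfolding split by (auto simp: v'_def power2_eq_square field_simps)
    qed
    ultimately show "0 \<le> quad_form_on I (\<lambda>i j. N i j - w i * w j) v"
      using nonneg[of v'] by simp
  qed
  from insert.IH[OF this] obtain u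
    where u: "\<And>i j. i \<in> I \<Longrightarrow> j \<in> I \<Longrightarrow> N i j - w i * w j = (\<Sum>k\<in>I. u k i * u k j)"
    by auto
  \<comment> \<open>The vector split off takes the index \<open>a\<close>; those from the induction
    are padded by \<open>0\<close> there.\<close>
  define u' where "u' = (\<lambda>k i. if k = a then w i else if i = a then 0 else u k i)"
  have "(\<Sum>k\<in>I. u' k i * u' k j) = (if i = a \<or> j = a then 0 else \<Sum>k\<in>I. u k i * u k j)" for i j
    using insert.hyps by (auto simp: u'_def intro!: sum.neutral sum.cong)
  then have "(\<Sum>k\<in>insert a I. u' k i * u' k j)
      = w i * w j + (if i = a \<or> j = a then 0 else \<Sum>k\<in>I. u k i * u k j)" for i j
    using insert.hyps by (simp add: u'_def)
  moreover have "N i j = w i * w j + (if i = a \<or> j = a then 0 else \<Sum>k\<in>I. u k i * u k j)"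
    if "i \<in> insert a I" "j \<in> insert a I" for i j
    using that u[of i j] row[of i] row[of j] comm[of i] by (auto simp: mult.commute)
  ultimately show ?case by (intro exI[of _ u']) auto
qed

text \<open>The Rayleigh quotient attains its minimum by compactness. A minimiser is an eigenvector
  and every eigenvalue is a value of the quotient, so the \<open>LEAST\<close> in the definition
  exists and is this minimum.\<close>

lemma lambda_min_on_le_quad_form:
  fixes S :: "'i::finite set"
  assumes "S \<noteq> {}" and "symmetric_on S N"
  shows "lambda_min_on S N * (\<Sum>i\<in>S. (v i)\<^sup>2) \<le> quad_form_on S N v"
proof -
  \<comment> \<open>The unit sphere of the coordinate subspace of \<open>S\<close>, embedded in the
    full space to have its topology at hand.\<close>
  define K where "K = {u :: real ^ 'i. norm u = 1 \<and> (\<forall>i. i \<notin> S \<longrightarrow> u $ i = 0)}"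
  define f where "f = (\<lambda>u :: real ^ 'i. quad_form_on S N (\<lambda>i. u $ i))"
  have norm_K: "(norm u)\<^sup>2 = (\<Sum>i\<in>S. (u $ i)\<^sup>2)" if "\<And>i. i \<notin> S \<Longrightarrow> u $ i = 0" for u :: "real ^ 'i"
    unfolding power2_norm_eq_inner inner_vec_def using that
    by (intro sum.mono_neutral_cong_right) (auto simp: power2_eq_square)
  have "compact K"
  proof -
    have "K = sphere 0 1 \<inter> (\<Inter>i\<in>-S. {u. u $ i = 0})" by (auto simp: K_def)
    moreover have "closed {u :: real ^ 'i. u $ i = 0}" for i
      by (intro closed_Collect_eq continuous_intros)
    ultimately show ?thesis by (auto intro!: compact_Int_closed)
  qed
  moreover have "K \<noteq> {}"
  proof -
    obtain i where "i \<in> S" using assms(1) by auto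
    then have "axis i 1 \<in> K" by (auto simp: K_def) (auto simp: axis_def)
    then show ?thesis by auto
  qed
  moreover have "continuous_on K f"
    unfolding f_def quad_form_on_def by (intro continuous_intros)
  ultimately obtain u0 where "u0 \<in> K" and min: "\<And>u. u \<in> K \<Longrightarrow> f u0 \<le> f u"
    using continuous_attains_inf[of K f] by auto
  have rayleigh: "f u0 * (\<Sum>i\<in>S. (v i)\<^sup>2) \<le> quad_form_on S N v" for v
  proof (cases "\<exists>i\<in>S. v i \<noteq> 0")
    case True
    define u :: "real ^ 'i" where "u = (\<chi> i. if i \<in> S then v i else 0)"
    have u: "(norm u)\<^sup>2 = (\<Sum>i\<in>S. (v i)\<^sup>2)"
      by (subst norm_K) (auto simp: u_def)
    have "u \<noteq> 0" using True by (auto simp: u_def vec_eq_iff)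
    then have "(1 / norm u) *\<^sub>R u \<in> K" by (auto simp: K_def u_def)
    then have "f u0 \<le> f ((1 / norm u) *\<^sub>R u)" by (rule min)
    also have "\<dots> = quad_form_on S N v / (norm u)\<^sup>2"
      unfolding f_def quad_form_on_def sum_divide_distrib
      by (intro sum.cong) (auto simp: u_def power2_eq_square)
    finally show ?thesis using \<open>u \<noteq> 0\<close> by (simp add: pos_le_divide_eq flip: u)
  next
    case False
    then show ?thesis by (simp add: quad_form_on_def)
  qed
  have shift: "quad_form_on S (\<lambda>i j. N i j - (if i = j then c else 0)) v
      = quad_form_on S N v - c * (\<Sum>i\<in>S. (v i)\<^sup>2)" for c v
  proof -
    have "quad_form_on S (\<lambda>i j. N i j - (if i = j then c else 0)) v
      = (\<Sum>i\<in>S. \<Sum>j\<in>S. v i * N i j * v j - (if i = j then c * (v i)\<^sup>2 else 0))"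
      unfolding quad_form_on_def by (intro sum.cong) (auto simp: algebra_simps power2_eq_square)
    then show ?thesis
      by (simp add: quad_form_on_def sum_subtractf sum_distrib_left)
  qed
  \<comment> \<open>Subtracting the minimum on the diagonal leaves a semidefinite form for which
    \<open>u0\<close> is isotropic, so \<open>psd_on_kernel\<close> makes \<open>u0\<close> an
    eigenvector.\<close>
  have "psd_on S (\<lambda>i j. N i j - (if i = j then f u0 else 0))"
    using assms(2) rayleigh by (auto simp: psd_on_def shift symmetric_on_def)
  moreover have unit: "(\<Sum>i\<in>S. (u0 $ i)\<^sup>2) = 1"
    using norm_K[of u0] \<open>u0 \<in> K\<close> by (auto simp: K_def)
  then have "quad_form_on S (\<lambda>i j. N i j - (if i = j then f u0 else 0)) (\<lambda>i. u0 $ i) = 0"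
    unfolding shift by (simp add: f_def)
  ultimately have "(\<Sum>j\<in>S. (N i j - (if i = j then f u0 else 0)) * u0 $ j) = 0" if "i \<in> S" for i
    using that by (intro psd_on_kernel) auto
  then have "(\<Sum>j\<in>S. N i j * u0 $ j) = f u0 * u0 $ i" if "i \<in> S" for i
    using that by (simp add: left_diff_distrib sum_subtractf if_distrib[of "\<lambda>x. x * _"] cong: if_cong)
  moreover have "\<exists>i\<in>S. u0 $ i \<noteq> 0"
    using unit by (metis (no_types, lifting) sum.neutral zero_neq_one zero_power2)
  ultimately have "eigenvalue_on S N (f u0)"
    unfolding eigenvalue_on_def by (intro exI[of _ "\<lambda>i. u0 $ i"]) auto
  moreover have "f u0 \<le> l" if "eigenvalue_on S N l" for l
  proof -
    from that obtain w where w: "\<exists>i\<in>S. w i \<noteq> 0" "\<And>i. i \<in> S \<Longrightarrow> (\<Sum>j\<in>S. N i j * w j) = l * w i"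
      by (auto simp: eigenvalue_on_def)
    have "quad_form_on S N w = (\<Sum>i\<in>S. w i * (\<Sum>j\<in>S. N i j * w j))"
      by (simp add: quad_form_on_def sum_distrib_left mult.assoc)
    also have "\<dots> = (\<Sum>i\<in>S. w i * (l * w i))" using w(2) by simp
    also have "\<dots> = l * (\<Sum>i\<in>S. (w i)\<^sup>2)"
      by (simp add: sum_distrib_left power2_eq_square mult_ac)
    finally have "f u0 * (\<Sum>i\<in>S. (w i)\<^sup>2) \<le> l * (\<Sum>i\<in>S. (w i)\<^sup>2)"
      using rayleigh[of w] by simp
    moreover have "0 < (\<Sum>i\<in>S. (w i)\<^sup>2)"
      using w(1) by (metis finite_code sum_pos2 zero_le_power2 zero_less_power2)
    ultimately show ?thesis by simp
  qed
  ultimately have "lambda_min_on S N = f u0"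
    unfolding lambda_min_on_def by (rule Least_equality)
  with rayleigh show ?thesis by simp
qed

subsection \<open>The dual certificate\<close>

text \<open>The hypotheses of the theorem in pointwise form. \<open>\<nu>\<close> stands for the
  least eigenvalue and enters through the bound \<open>G_ge\<close>; \<open>slack_on\<close> is the
  formula for \<open>\<mu>\<^sub>3\<close> with the minimum replaced by a bound at each index;
  \<open>residual_le\<close> is (A1); \<open>\<mu>\<^sub>2_le\<close>, \<open>Theta_split\<close>
  and the assumptions after it are (A2).\<close>

locale dual_certificate =
  fixes G :: "'d::finite \<Rightarrow> 'd \<Rightarrow> real" and y x :: "'d \<Rightarrow> real" and S :: "'d set"
    and Y11 \<delta> \<nu> \<mu>\<^sub>2 \<mu>\<^sub>3 :: real and \<Theta>\<^sub>1 \<Theta>\<^sub>2 :: "'d \<Rightarrow> 'd \<Rightarrow> real"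
  assumes G_sym: "G i j = G j i"
    and x_on: "i \<in> S \<Longrightarrow> x i * x i = 1"
    and x_off: "i \<notin> S \<Longrightarrow> x i = 0"
    and S_ne: "S \<noteq> {}"
    and Y11_eq: "Y11 = - (\<Sum>i\<in>S. y i * x i)"
    and Y11_pos: "0 < Y11"
    and \<delta>_pos: "0 < \<delta>"
    and G_ge: "\<nu> * (\<Sum>i\<in>S. (v i)\<^sup>2) \<le> quad_form_on S G v"
    and slack_on: "i \<in> S \<Longrightarrow>
      \<delta> - \<nu> \<le> (- y i - (\<Sum>j\<in>S. G i j * x j)) / x i - real (card S) * \<mu>\<^sub>3"
    and \<mu>\<^sub>2_le: "\<mu>\<^sub>2 \<le> \<delta> - \<nu>"
    and \<mu>\<^sub>3_nonneg: "0 \<le> \<mu>\<^sub>3"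
    and residual_le: "i \<notin> S \<Longrightarrow> \<bar>y i + (\<Sum>j\<in>S. G i j * x j)\<bar> \<le> real (card S) * \<mu>\<^sub>3"
    and Theta_split: "i \<notin> S \<Longrightarrow> j \<notin> S \<Longrightarrow>
      G i j + \<mu>\<^sub>2 * (if i = j then 1 else 0) - 1 / Y11 * (y i * y j)
      - (\<Sum>k\<in>S. \<Sum>l\<in>S. (G i k - 1 / Y11 * (y i * y k))
          * (1 / \<delta> * ((if k = l then 1 else 0) - 1 / real (card S) * (x k * x l)))
          * (G j l - 1 / Y11 * (y j * y l)))
      = \<Theta>\<^sub>1 i j + \<Theta>\<^sub>2 i j"
    and Theta1_psd: "psd_on (- S) \<Theta>\<^sub>1"
    and Theta2_le: "i \<notin> S \<Longrightarrow> j \<notin> S \<Longrightarrow> \<bar>\<Theta>\<^sub>2 i j\<bar> \<le> \<mu>\<^sub>3"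
    and strict: "pd_on (- S) \<Theta>\<^sub>1 \<or> (\<forall>i\<in>- S. \<forall>j\<in>- S. \<bar>\<Theta>\<^sub>2 i j\<bar> < \<mu>\<^sub>3)"
begin

abbreviation s :: real where "s \<equiv> real (card S)"

text \<open>Half the gradient of the least-squares objective at \<open>x\<close>.\<close>

definition residual :: "'d \<Rightarrow> real" where
  "residual i = y i + (\<Sum>j\<in>S. G i j * x j)"

text \<open>The trace multiplier \<open>\<mu>\<^sub>2\<close> plus the multiplier of the constraint on the diagonal, which is \<open>0\<close> off
  the support.\<close>

definition slack :: "'d \<Rightarrow> real" where
  "slack i = (if i \<in> S then (- y i - (\<Sum>j\<in>S. G i j * x j)) / x i - s * \<mu>\<^sub>3 else \<mu>\<^sub>2)"

text \<open>\<open>\<mu>\<^sub>3\<close> times a subgradient of the entrywise 1-norm at \<open>x x\<^sup>T\<close>.\<close>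

definition subgrad :: "'d \<Rightarrow> 'd \<Rightarrow> real" where
  "subgrad i j =
    (if i \<in> S then if j \<in> S then \<mu>\<^sub>3 * (x i * x j) else - (x i * residual j) / s
     else if j \<in> S then - (residual i * x j) / s else - \<Theta>\<^sub>2 i j)"

text \<open>The lower block of the dual slack matrix, as dictated by stationarity of the
  Lagrangian.\<close>

definition D :: "'d \<Rightarrow> 'd \<Rightarrow> real" where
  "D i j = G i j + (if i = j then slack i else 0) + subgrad i j"

text \<open>Entries of the Schur complement of the corner \<open>Y11\<close> in the matrix with
  blocks \<open>Y11\<close>, \<open>y\<close>, \<open>G\<close>.\<close>

definition R :: "'d \<Rightarrow> 'd \<Rightarrow> real" where
  "R i k = G i k - 1 / Y11 * (y i * y k)"

text \<open>The quadratic form of the dual slack matrix with blocks \<open>Y11\<close>, \<open>y\<close>, \<open>D\<close>.\<close>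

definition Q :: "real \<Rightarrow> ('d \<Rightarrow> real) \<Rightarrow> real" where
  "Q t v = Y11 * t\<^sup>2 + 2 * t * (\<Sum>i\<in>UNIV. y i * v i) + quad_form_on UNIV D v"

section \<open>Symmetry and kernel of the dual slack matrix\<close>

lemma s_pos: "0 < s"
  using S_ne by (simp add: card_gt_0_iff)

lemma sum_x2: "(\<Sum>i\<in>S. x i * x i) = s"
  using x_on by simp

lemma sum_x: "(\<Sum>i\<in>UNIV. f i * x i) = (\<Sum>i\<in>S. f i * x i)"
  using x_off by (intro sum.mono_neutral_cong_right) auto

lemma x_nonzero: "i \<in> S \<Longrightarrow> x i \<noteq> 0"
  using x_on by fastforce

text \<open>Symmetry of \<open>\<Theta>\<^sub>2\<close> is inherited as the difference of
  \<open>\<Theta>\<close>, symmetric by its formula, and the semidefinite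
  \<open>\<Theta>\<^sub>1\<close>.\<close>

lemma Theta2_sym: "i \<notin> S \<Longrightarrow> j \<notin> S \<Longrightarrow> \<Theta>\<^sub>2 i j = \<Theta>\<^sub>2 j i"
proof -
  assume i: "i \<notin> S" and j: "j \<notin> S"
  have "(\<Sum>k\<in>S. \<Sum>l\<in>S. (G i k - 1 / Y11 * (y i * y k))
          * (1 / \<delta> * ((if k = l then 1 else 0) - 1 / s * (x k * x l)))
          * (G j l - 1 / Y11 * (y j * y l)))
      = (\<Sum>k\<in>S. \<Sum>l\<in>S. (G j k - 1 / Y11 * (y j * y k))
          * (1 / \<delta> * ((if k = l then 1 else 0) - 1 / s * (x k * x l)))
          * (G i l - 1 / Y11 * (y i * y l)))"
    by (subst sum.swap) (intro sum.cong refl, simp add: mult_ac)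
  moreover have "\<Theta>\<^sub>1 i j = \<Theta>\<^sub>1 j i"
    using Theta1_psd i j by (auto simp: psd_on_def symmetric_on_def)
  ultimately show "\<Theta>\<^sub>2 i j = \<Theta>\<^sub>2 j i"
    using Theta_split[OF i j] Theta_split[OF j i] G_sym[of i j] by (simp add: mult.commute eq_commute)
qed

lemma subgrad_sym: "subgrad i j = subgrad j i"
  using Theta2_sym by (auto simp: subgrad_def mult.commute)

lemma D_sym: "symmetric_on I D"
  using G_sym subgrad_sym by (auto simp: symmetric_on_def D_def)

text \<open>The lower rows of the kernel equation for \<open>(1, x)\<close>. On the support
  \<open>slack\<close> is solved from it; off the support the mixed block of \<open>subgrad\<close>
  contributes minus the residual, which cancels the \<open>G\<close> part.\<close>

lemma D_x: "(\<Sum>j\<in>UNIV. D i j * x j) = - y i"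
proof (cases "i \<in> S")
  case True
  have "(\<Sum>j\<in>S. D i j * x j)
    = (\<Sum>j\<in>S. G i j * x j + (if i = j then slack i * x i else 0) + \<mu>\<^sub>3 * x i * (x j * x j))"
    using True by (intro sum.cong) (auto simp: D_def subgrad_def algebra_simps)
  also have "\<dots> = (\<Sum>j\<in>S. G i j * x j) + slack i * x i + \<mu>\<^sub>3 * x i * s"
    using True by (simp add: sum.distrib sum_x2 flip: sum_distrib_left)
  also have "\<dots> = - y i"
    using True x_nonzero by (simp add: slack_def field_simps)
  finally show ?thesis by (simp add: sum_x)
next
  case False
  then have "(\<Sum>j\<in>S. D i j * x j) = (\<Sum>j\<in>S. G i j * x j - residual i / s * (x j * x j))"
    by (intro sum.cong) (auto simp: D_def subgrad_def algebra_simps)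
  also have "\<dots> = (\<Sum>j\<in>S. G i j * x j) - residual i"
    by (simp only: sum_subtractf sum_x2 flip: sum_distrib_left) (simp add: S_ne)
  finally show ?thesis by (simp add: sum_x residual_def)
qed

text \<open>Translation by a kernel vector. The top row of the kernel equation is the definition of
  \<open>Y11\<close>.\<close>

lemma Q_shift: "Q (t + r) (\<lambda>i. v i + r * x i) = Q t v"
proof -
  have yx: "(\<Sum>i\<in>UNIV. y i * x i) = - Y11"
    by (simp add: sum_x Y11_eq)
  have "quad_form_on UNIV D x = (\<Sum>i\<in>UNIV. x i * (\<Sum>j\<in>UNIV. D i j * x j))"
    by (simp add: quad_form_on_def sum_distrib_left mult.assoc)
  also have "\<dots> = Y11"
    unfolding D_x using yx by (simp add: sum_negf mult.commute)
  finally have xx: "quad_form_on UNIV D x = Y11" .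
  have "(\<Sum>i\<in>UNIV. x i * (\<Sum>j\<in>UNIV. D i j * v j)) = (\<Sum>j\<in>UNIV. v j * (\<Sum>i\<in>UNIV. D j i * x i))"
    using D_sym[of UNIV] unfolding sum_distrib_left symmetric_on_def
    by (subst sum.swap) (intro sum.cong refl, simp add: mult_ac)
  also have "\<dots> = - (\<Sum>i\<in>UNIV. y i * v i)"
    unfolding D_x by (simp add: sum_negf mult.commute)
  finally have xv: "(\<Sum>i\<in>UNIV. x i * (\<Sum>j\<in>UNIV. D i j * v j)) = - (\<Sum>i\<in>UNIV. y i * v i)" .
  have "(\<Sum>i\<in>UNIV. y i * (v i + r * x i)) = (\<Sum>i\<in>UNIV. y i * v i) + r * (\<Sum>i\<in>UNIV. y i * x i)"
    by (simp add: sum.distrib sum_distrib_left algebra_simps)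
  then have yvx: "(\<Sum>i\<in>UNIV. y i * (v i + r * x i)) = (\<Sum>i\<in>UNIV. y i * v i) - r * Y11"
    by (simp add: yx)
  show ?thesis
    unfolding Q_def quad_form_on_add[OF D_sym] xv xx yvx by (simp add: power2_eq_square algebra_simps)
qed

section \<open>Lower bounds for the slack form\<close>

lemma quad_form_S_ge: "\<delta> * (\<Sum>i\<in>S. (v i)\<^sup>2) \<le> quad_form_on S D v"
proof -
  \<comment> \<open>On the support \<open>subgrad\<close> is a nonnegative multiple of a rank-one
    square, \<open>G\<close> contributes at least \<open>\<nu>\<close>, and the diagonal at least
    \<open>\<delta> - \<nu>\<close>.\<close>
  have "quad_form_on S D v = (\<Sum>i\<in>S. \<Sum>j\<in>S. v i * G i j * v j
      + (if i = j then slack i * (v i)\<^sup>2 else 0) + \<mu>\<^sub>3 * ((x i * v i) * (x j * v j)))"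
    unfolding quad_form_on_def
    by (intro sum.cong) (auto simp: D_def subgrad_def algebra_simps power2_eq_square)
  also have "\<dots> = quad_form_on S G v + (\<Sum>i\<in>S. slack i * (v i)\<^sup>2) + \<mu>\<^sub>3 * (\<Sum>i\<in>S. x i * v i)\<^sup>2"
  proof -
    have "(\<Sum>i\<in>S. \<Sum>j\<in>S. \<mu>\<^sub>3 * ((x i * v i) * (x j * v j))) = \<mu>\<^sub>3 * (\<Sum>i\<in>S. x i * v i)\<^sup>2"
      by (simp only: power2_eq_square flip: sum_distrib_left sum_distrib_right)
    then show ?thesis by (simp only: quad_form_on_def sum.distrib) simp
  qed
  finally have eq: "quad_form_on S D v
      = quad_form_on S G v + (\<Sum>i\<in>S. slack i * (v i)\<^sup>2) + \<mu>\<^sub>3 * (\<Sum>i\<in>S. x i * v i)\<^sup>2" .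
  have "(\<Sum>i\<in>S. (\<delta> - \<nu>) * (v i)\<^sup>2) \<le> (\<Sum>i\<in>S. slack i * (v i)\<^sup>2)"
    using slack_on by (intro sum_mono mult_right_mono) (auto simp: slack_def)
  then have "\<delta> * (\<Sum>i\<in>S. (v i)\<^sup>2) - \<nu> * (\<Sum>i\<in>S. (v i)\<^sup>2) \<le> (\<Sum>i\<in>S. slack i * (v i)\<^sup>2)"
    by (simp only: left_diff_distrib sum_subtractf flip: sum_distrib_left)
  moreover have "0 \<le> \<mu>\<^sub>3 * (\<Sum>i\<in>S. x i * v i)\<^sup>2"
    using \<mu>\<^sub>3_nonneg by simp
  ultimately show ?thesis
    using G_ge[of v] unfolding eq by linarith
qed

text \<open>On the hyperplane \<open>y\<^sub>S \<bullet> v\<^sub>S = 0\<close> the off-diagonal block of \<open>D\<close> acts like \<open>R\<close> composed with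
  the projection along \<open>x\<close>, so that completing the square yields the Schur complement \<open>\<Theta>\<close>.\<close>

lemma Q_ge:
  assumes orth: "(\<Sum>k\<in>S. y k * v k) = 0"
  defines "g \<equiv> \<lambda>k. \<Sum>i\<in>- S. v i * R i k"
  defines "P \<equiv> \<lambda>k. g k - (\<Sum>l\<in>S. x l * g l) / s * x k"
  shows "Y11 * (t + (\<Sum>i\<in>- S. y i * v i) / Y11)\<^sup>2 + \<delta> * (\<Sum>k\<in>S. (v k + P k / \<delta>)\<^sup>2)
    + quad_form_on (- S) \<Theta>\<^sub>1 v \<le> Q t v"
proof -
  define c where "c = (\<Sum>i\<in>- S. y i * v i)"
  define xg where "xg = (\<Sum>l\<in>S. x l * g l)"
  have UN: "(UNIV :: 'd set) = S \<union> - S" by auto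
  have yv: "(\<Sum>i\<in>UNIV. y i * v i) = c"
    unfolding UN c_def using orth by (subst sum.union_disjoint) auto
  have off: "(\<Sum>j\<in>S. D i j * v j) = (\<Sum>k\<in>S. R i k * v k) - (\<Sum>k\<in>S. R i k * x k) / s * (\<Sum>k\<in>S. x k * v k)"
    if "i \<notin> S" for i
  proof -
    have "(\<Sum>k\<in>S. R i k * v k) = (\<Sum>k\<in>S. G i k * v k) - y i / Y11 * (\<Sum>k\<in>S. y k * v k)"
      unfolding R_def sum_distrib_left sum_subtractf[symmetric]
      by (intro sum.cong) (auto simp: algebra_simps)
    then have Rv: "(\<Sum>k\<in>S. R i k * v k) = (\<Sum>k\<in>S. G i k * v k)"
      by (simp add: orth)
    \<comment> \<open>As \<open>y\<close> pairs with \<open>x\<close> to \<open>- Y11\<close>, the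
      rank-one correction in \<open>R\<close> turns the product of \<open>G\<close> and
      \<open>x\<close> into the residual, which is the coefficient in the mixed block of
      \<open>subgrad\<close>.\<close>
    have "(\<Sum>k\<in>S. R i k * x k) = (\<Sum>k\<in>S. G i k * x k) - y i / Y11 * (\<Sum>k\<in>S. y k * x k)"
      unfolding R_def sum_distrib_left sum_subtractf[symmetric]
      by (intro sum.cong) (auto simp: algebra_simps)
    moreover have "(\<Sum>k\<in>S. y k * x k) = - Y11" using Y11_eq by simp
    ultimately have Rx: "(\<Sum>k\<in>S. R i k * x k) = residual i"
      using Y11_pos by (simp add: residual_def)
    have "(\<Sum>j\<in>S. D i j * v j) = (\<Sum>k\<in>S. G i k * v k) - residual i / s * (\<Sum>k\<in>S. x k * v k)"
      unfolding sum_distrib_left sum_subtractf[symmetric] using that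
      by (intro sum.cong) (auto simp: D_def subgrad_def algebra_simps)
    then show ?thesis by (simp add: Rv Rx)
  qed
  have swap: "(\<Sum>i\<in>- S. v i * (\<Sum>k\<in>S. R i k * f k)) = (\<Sum>k\<in>S. g k * f k)" for f
    unfolding g_def sum_distrib_left sum_distrib_right
    by (subst sum.swap) (simp add: mult_ac)
  have "(\<Sum>i\<in>- S. \<Sum>j\<in>S. v i * D i j * v j) = (\<Sum>i\<in>- S. v i * (\<Sum>j\<in>S. D i j * v j))"
    by (simp add: sum_distrib_left mult.assoc)
  also have "\<dots> = (\<Sum>i\<in>- S. v i * (\<Sum>k\<in>S. R i k * v k)
      - v i * (\<Sum>k\<in>S. R i k * x k) * ((\<Sum>k\<in>S. x k * v k) / s))"
    by (intro sum.cong) (auto simp: off right_diff_distrib mult.assoc)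
  also have "\<dots> = (\<Sum>k\<in>S. g k * v k) - (\<Sum>k\<in>S. g k * x k) * ((\<Sum>k\<in>S. x k * v k) / s)"
    by (simp only: sum_subtractf swap flip: sum_distrib_right)
  also have "(\<Sum>k\<in>S. g k * x k) = xg" by (simp add: xg_def mult.commute)
  also have "(\<Sum>k\<in>S. g k * v k) - xg * ((\<Sum>k\<in>S. x k * v k) / s) = (\<Sum>k\<in>S. P k * v k)"
    unfolding P_def xg_def[symmetric] sum_distrib_left sum_divide_distrib sum_subtractf[symmetric]
    by (intro sum.cong) (auto simp: algebra_simps)
  finally have cross: "(\<Sum>i\<in>- S. \<Sum>j\<in>S. v i * D i j * v j) = (\<Sum>k\<in>S. P k * v k)" .
  \<comment> \<open>Pythagoras: \<open>P\<close> is the component of \<open>g\<close> orthogonal to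
    \<open>x\<close>, whose squared length on the support is \<open>s\<close>.\<close>
  have "(\<Sum>k\<in>S. (P k)\<^sup>2) = (\<Sum>k\<in>S. (g k)\<^sup>2 - 2 * xg / s * (x k * g k) + (xg / s)\<^sup>2 * (x k * x k))"
    unfolding P_def xg_def[symmetric] by (intro sum.cong) (auto simp: algebra_simps power2_eq_square)
  also have "\<dots> = (\<Sum>k\<in>S. (g k)\<^sup>2) - 2 * xg / s * xg + (xg / s)\<^sup>2 * s"
    by (simp only: sum.distrib sum_subtractf sum_x2 xg_def flip: sum_distrib_left)
  also have "\<dots> = (\<Sum>k\<in>S. (g k)\<^sup>2) - xg\<^sup>2 / s"
    using s_pos by (simp add: power2_eq_square field_simps)
  finally have PP: "(\<Sum>k\<in>S. (P k)\<^sup>2) = (\<Sum>k\<in>S. (g k)\<^sup>2) - xg\<^sup>2 / s" .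
  \<comment> \<open>The last matrix subtracted in \<open>\<Theta>\<close>; its form is the squared
    length of \<open>P\<close> divided by \<open>\<delta>\<close>.\<close>
  define T where "T = (\<lambda>i j. \<Sum>k\<in>S. \<Sum>l\<in>S. R i k
      * (1 / \<delta> * ((if k = l then 1 else 0) - 1 / s * (x k * x l))) * R j l)"
  have T_eq: "T i j = 1 / \<delta> * ((\<Sum>k\<in>S. R i k * R j k) - (\<Sum>k\<in>S. R i k * x k) * (\<Sum>k\<in>S. R j k * x k) / s)"
    for i j
  proof -
    have "T i j = (\<Sum>k\<in>S. \<Sum>l\<in>S. (if k = l then 1 / \<delta> * (R i k * R j k) else 0)
        - 1 / \<delta> / s * ((R i k * x k) * (R j l * x l)))"
      unfolding T_def by (intro sum.cong) (auto simp: algebra_simps)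
    also have "\<dots> = 1 / \<delta> * (\<Sum>k\<in>S. R i k * R j k)
        - 1 / \<delta> / s * ((\<Sum>k\<in>S. R i k * x k) * (\<Sum>k\<in>S. R j k * x k))"
    proof -
      have "(\<Sum>k\<in>S. \<Sum>l\<in>S. if k = l then 1 / \<delta> * (R i k * R j k) else 0) = 1 / \<delta> * (\<Sum>k\<in>S. R i k * R j k)"
        by (simp add: sum_distrib_left)
      moreover have "(\<Sum>k\<in>S. \<Sum>l\<in>S. 1 / \<delta> / s * ((R i k * x k) * (R j l * x l)))
          = 1 / \<delta> / s * ((\<Sum>k\<in>S. R i k * x k) * (\<Sum>k\<in>S. R j k * x k))"
        by (simp only: flip: sum_distrib_left sum_distrib_right)
      ultimately show ?thesis by (simp only: sum_subtractf)
    qed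
    finally show ?thesis by (simp add: algebra_simps)
  qed
  have "quad_form_on (- S) T v = (\<Sum>i\<in>- S. \<Sum>j\<in>- S. 1 / \<delta> * (v i * v j * (\<Sum>k\<in>S. R i k * R j k))
      - 1 / \<delta> / s * ((v i * (\<Sum>k\<in>S. R i k * x k)) * (v j * (\<Sum>k\<in>S. R j k * x k))))"
    unfolding quad_form_on_def T_eq by (intro sum.cong refl) (simp add: algebra_simps)
  also have "\<dots> = 1 / \<delta> * (\<Sum>i\<in>- S. \<Sum>j\<in>- S. v i * v j * (\<Sum>k\<in>S. R i k * R j k))
      - 1 / \<delta> / s * ((\<Sum>i\<in>- S. v i * (\<Sum>k\<in>S. R i k * x k)) * (\<Sum>i\<in>- S. v i * (\<Sum>k\<in>S. R i k * x k)))"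
    by (simp only: sum_subtractf flip: sum_distrib_left sum_distrib_right)
  also have "(\<Sum>i\<in>- S. \<Sum>j\<in>- S. v i * v j * (\<Sum>k\<in>S. R i k * R j k)) = (\<Sum>k\<in>S. (g k)\<^sup>2)"
    unfolding g_def power2_eq_square sum_product sum_distrib_left
    by (subst sum.swap[of _ S], subst sum.swap[of _ S]) (simp add: sum_distrib_left sum_distrib_right mult_ac)
  also have "(\<Sum>i\<in>- S. v i * (\<Sum>k\<in>S. R i k * x k)) = xg"
    unfolding swap by (simp add: xg_def mult.commute)
  finally have TT: "quad_form_on (- S) T v = 1 / \<delta> * (\<Sum>k\<in>S. (P k)\<^sup>2)"
    unfolding PP by (simp add: right_diff_distrib power2_eq_square[of xg])
  have "quad_form_on (- S) D v
      = (\<Sum>i\<in>- S. \<Sum>j\<in>- S. v i * \<Theta>\<^sub>1 i j * v j + v i * T i j * v j + 1 / Y11 * ((y i * v i) * (y j * v j)))"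
    unfolding quad_form_on_def
  proof (intro sum.cong refl)
    fix i j assume "i \<in> - S" "j \<in> - S"
    \<comment> \<open>Off the support the diagonal of \<open>D\<close> carries
      \<open>\<mu>\<^sub>2\<close> and \<open>subgrad\<close> is \<open>- \<Theta>\<^sub>2\<close>,
      so \<open>D\<close> is \<open>\<Theta>\<^sub>1\<close> plus the two corrections subtracted in
      \<open>\<Theta>\<close>.\<close>
    then have "D i j = \<Theta>\<^sub>1 i j + T i j + 1 / Y11 * (y i * y j)"
      using Theta_split[of i j] unfolding T_def R_def D_def subgrad_def slack_def by auto
    then show "v i * D i j * v j
        = v i * \<Theta>\<^sub>1 i j * v j + v i * T i j * v j + 1 / Y11 * ((y i * v i) * (y j * v j))"
      by (simp add: algebra_simps)
  qed
  also have "\<dots> = quad_form_on (- S) \<Theta>\<^sub>1 v + quad_form_on (- S) T v + 1 / Y11 * c\<^sup>2"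
    unfolding quad_form_on_def c_def power2_eq_square sum_product
    by (simp only: sum.distrib sum_distrib_left)
  finally have DSc: "quad_form_on (- S) D v
      = quad_form_on (- S) \<Theta>\<^sub>1 v + 1 / \<delta> * (\<Sum>k\<in>S. (P k)\<^sup>2) + 1 / Y11 * c\<^sup>2"
    by (simp add: TT)
  have "quad_form_on UNIV D v
      = quad_form_on S D v + 2 * (\<Sum>k\<in>S. P k * v k) + quad_form_on (- S) D v"
    unfolding UN cross[symmetric] by (intro quad_form_on_Un D_sym) auto
  \<comment> \<open>The square in the support part uses up the contribution of \<open>T\<close>, the
    square in \<open>t\<close> that of the rank-one term in \<open>y\<close>.\<close>
  moreover have "\<delta> * (\<Sum>k\<in>S. (v k + P k / \<delta>)\<^sup>2)
      = \<delta> * (\<Sum>k\<in>S. (v k)\<^sup>2) + 2 * (\<Sum>k\<in>S. P k * v k) + 1 / \<delta> * (\<Sum>k\<in>S. (P k)\<^sup>2)"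
    unfolding sum_distrib_left sum.distrib[symmetric] using \<delta>_pos
    by (intro sum.cong) (auto simp: power2_eq_square field_simps)
  moreover have "Y11 * (t + c / Y11)\<^sup>2 = Y11 * t\<^sup>2 + 2 * t * c + 1 / Y11 * c\<^sup>2"
    using Y11_pos by (simp add: power2_eq_square field_simps)
  ultimately show ?thesis
    using quad_form_S_ge[of v] unfolding Q_def yv DSc c_def[symmetric] by linarith
qed

text \<open>Every vector can be translated along \<open>x\<close> into the hyperplane, since
  \<open>x\<close> pairs with \<open>y\<close> to \<open>- Y11\<close>, which is nonzero.\<close>

lemma Q_shift_orth:
  assumes "r = (\<Sum>i\<in>S. y i * v i) / Y11"
  shows "(\<Sum>k\<in>S. y k * (v k + r * x k)) = 0"
proof -
  have "(\<Sum>k\<in>S. y k * (v k + r * x k)) = (\<Sum>k\<in>S. y k * v k) + r * (\<Sum>k\<in>S. y k * x k)"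
    by (simp add: sum.distrib sum_distrib_left algebra_simps)
  moreover have "(\<Sum>k\<in>S. y k * x k) = - Y11" using Y11_eq by simp
  ultimately show ?thesis using assms Y11_pos by simp
qed

lemma squares_nonneg: "0 \<le> Y11 * a\<^sup>2 + \<delta> * (\<Sum>k\<in>S. (f k)\<^sup>2)"
  using Y11_pos \<delta>_pos by (intro add_nonneg_nonneg mult_nonneg_nonneg sum_nonneg) auto

text \<open>Translating into the hyperplane changes neither \<open>Q\<close> nor the entries off the
  support; the squares in \<open>Q_ge\<close> are then dropped.\<close>

lemma Q_ge_Theta1: "quad_form_on (- S) \<Theta>\<^sub>1 v \<le> Q t v"
proof -
  define r where "r = (\<Sum>i\<in>S. y i * v i) / Y11"
  have "quad_form_on (- S) \<Theta>\<^sub>1 v = quad_form_on (- S) \<Theta>\<^sub>1 (\<lambda>i. v i + r * x i)"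
    using x_off by (intro quad_form_on_cong) auto
  also have "\<dots> \<le> Q (t + r) (\<lambda>i. v i + r * x i)"
    by (rule order_trans[OF _ Q_ge[OF Q_shift_orth[OF r_def]]])
      (rule le_add_same_cancel2[THEN iffD2, OF squares_nonneg])
  finally show ?thesis by (simp add: Q_shift)
qed

lemma Q_nonneg: "0 \<le> Q t v"
  using Q_ge_Theta1[of v t] Theta1_psd unfolding psd_on_def by (meson order_trans)

text \<open>For \<open>v\<close> supported on \<open>S\<close> the vectors \<open>g\<close> and
  \<open>P\<close> of \<open>Q_ge\<close> vanish, so after translation both squares are forced to be
  zero. Undoing the translation leaves a multiple of \<open>(1, x)\<close>.\<close>

lemma Q_eq_0:
  assumes "Q t v = 0" and off: "\<And>i. i \<notin> S \<Longrightarrow> v i = 0"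
  shows "v i = t * x i"
proof -
  define r where "r = (\<Sum>i\<in>S. y i * v i) / Y11"
  define w where "w = (\<lambda>i. v i + r * x i)"
  have w_off: "w i = 0" if "i \<notin> S" for i
    using that by (simp add: w_def off x_off)
  have orth: "(\<Sum>k\<in>S. y k * w k) = 0"
    unfolding w_def by (rule Q_shift_orth[OF r_def])
  have "Q (t + r) w = 0"
    using assms(1) by (simp add: w_def Q_shift)
  moreover have "quad_form_on (- S) \<Theta>\<^sub>1 w = 0"
    by (simp add: quad_form_on_def w_off)
  ultimately have le: "Y11 * (t + r)\<^sup>2 + \<delta> * (\<Sum>k\<in>S. (w k)\<^sup>2) \<le> 0"
    using Q_ge[OF orth, of "t + r"] by (simp add: w_off)
  have "0 \<le> \<delta> * (\<Sum>k\<in>S. (w k)\<^sup>2)" "0 \<le> Y11 * (t + r)\<^sup>2"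
    using \<delta>_pos Y11_pos by (auto intro!: mult_nonneg_nonneg sum_nonneg)
  with le have "Y11 * (t + r)\<^sup>2 = 0" "\<delta> * (\<Sum>k\<in>S. (w k)\<^sup>2) = 0" by linarith+
  then have "r = - t" and "\<And>k. k \<in> S \<Longrightarrow> w k = 0"
    using \<delta>_pos Y11_pos by (auto simp: sum_nonneg_eq_0_iff)
  then show ?thesis using w_off[of i] by (cases "i \<in> S") (auto simp: w_def)
qed

section \<open>Weak duality and complementary slackness\<close>

text \<open>The objective of the relaxation without the constant \<open>(b \<bullet> b) / n\<close>.\<close>

definition objective :: "('d option \<Rightarrow> 'd option \<Rightarrow> real) \<Rightarrow> real" where
  "objective W = 2 * (\<Sum>i\<in>UNIV. y i * W None (Some i))
     + (\<Sum>i\<in>UNIV. \<Sum>j\<in>UNIV. G i j * W (Some i) (Some j))"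

text \<open>For symmetric \<open>W\<close>, the trace inner product with the dual slack
  matrix.\<close>

definition pairing :: "('d option \<Rightarrow> 'd option \<Rightarrow> real) \<Rightarrow> real" where
  "pairing W = Y11 * W None None + 2 * (\<Sum>i\<in>UNIV. y i * W None (Some i))
     + (\<Sum>i\<in>UNIV. \<Sum>j\<in>UNIV. D i j * W (Some i) (Some j))"

text \<open>The dual value: minus the right-hand sides of the constraints, weighted by their
  multipliers.\<close>

definition optimum :: real where
  "optimum = - Y11 - (\<mu>\<^sub>2 * s + (\<Sum>i\<in>S. slack i - \<mu>\<^sub>2)) - \<mu>\<^sub>3 * s\<^sup>2"

definition lift :: "'d option \<Rightarrow> 'd option \<Rightarrow> real" where
  "lift i j = case_option 1 x i * case_option 1 x j"

lemma objective_eq: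
  assumes "W None None = 1"
  shows "objective W = pairing W - Y11 - (\<Sum>i\<in>UNIV. slack i * W (Some i) (Some i))
    - (\<Sum>i\<in>UNIV. \<Sum>j\<in>UNIV. subgrad i j * W (Some i) (Some j))"
proof -
  have "(\<Sum>i\<in>UNIV. \<Sum>j\<in>UNIV. D i j * W (Some i) (Some j))
    = (\<Sum>i\<in>UNIV. \<Sum>j\<in>UNIV. G i j * W (Some i) (Some j)
        + (if i = j then slack i * W (Some i) (Some i) else 0) + subgrad i j * W (Some i) (Some j))"
    by (intro sum.cong) (auto simp: D_def algebra_simps)
  then show ?thesis
    using assms by (simp add: objective_def pairing_def sum.distrib)
qed

text \<open>The pairing is linear in \<open>W\<close> and takes the value of \<open>Q\<close> at
  each rank-one term.\<close>

lemma pairing_decomposition: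
  assumes "\<And>i j. W i j = (\<Sum>k\<in>K. u k i * u k j)"
  shows "pairing W = (\<Sum>k\<in>K. Q (u k None) (\<lambda>i. u k (Some i)))"
proof -
  have "(\<Sum>i\<in>UNIV. y i * W None (Some i)) = (\<Sum>k\<in>K. u k None * (\<Sum>i\<in>UNIV. y i * u k (Some i)))"
    unfolding assms sum_distrib_left by (subst sum.swap) (simp add: mult_ac)
  moreover have "(\<Sum>i\<in>UNIV. \<Sum>j\<in>UNIV. D i j * W (Some i) (Some j))
      = (\<Sum>k\<in>K. quad_form_on UNIV D (\<lambda>i. u k (Some i)))"
    unfolding assms sum_distrib_left quad_form_on_def
    by (subst sum.swap[of _ K], subst sum.swap[of _ K]) (simp add: mult_ac)
  ultimately show ?thesis
    unfolding pairing_def Q_def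
    by (simp add: assms sum.distrib sum_distrib_left power2_eq_square mult_ac)
qed

text \<open>Dual feasibility for the 1-norm: (A1) bounds the mixed blocks and (A2) the block off the
  support.\<close>

lemma abs_subgrad_le: "\<bar>subgrad i j\<bar> \<le> \<mu>\<^sub>3"
proof -
  have x1: "\<bar>x i\<bar> = 1" if "i \<in> S" for i
    using x_on[OF that] by (metis abs_mult_self_eq abs_1 square_eq_1_iff abs_minus_cancel)
  have "\<bar>residual i\<bar> / s \<le> \<mu>\<^sub>3" if "i \<notin> S" for i
    using residual_le[OF that] s_pos by (simp only: residual_def pos_divide_le_eq mult.commute)
  then show ?thesis
    using Theta2_le \<mu>\<^sub>3_nonneg x1 by (auto simp: subgrad_def abs_mult)
qed

text \<open>The multipliers \<open>slack i - \<mu>\<^sub>2\<close> of the diagonal bounds are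
  nonnegative, which on the support is where the upper bound on \<open>\<mu>\<^sub>2\<close>
  enters.\<close>

lemma sum_slack_le:
  assumes "(\<Sum>i\<in>UNIV. X i) = s" and "\<And>i. X i \<le> 1"
  shows "(\<Sum>i\<in>UNIV. slack i * X i) \<le> \<mu>\<^sub>2 * s + (\<Sum>i\<in>S. slack i - \<mu>\<^sub>2)"
proof -
  have "(\<Sum>i\<in>UNIV. slack i * X i) = \<mu>\<^sub>2 * s + (\<Sum>i\<in>UNIV. (slack i - \<mu>\<^sub>2) * X i)"
    unfolding assms(1)[symmetric] sum_distrib_left sum.distrib[symmetric]
    by (intro sum.cong) (auto simp: algebra_simps)
  also have "(\<Sum>i\<in>UNIV. (slack i - \<mu>\<^sub>2) * X i) = (\<Sum>i\<in>S. (slack i - \<mu>\<^sub>2) * X i)"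
    by (intro sum.mono_neutral_right) (auto simp: slack_def)
  also have "\<dots> \<le> (\<Sum>i\<in>S. slack i - \<mu>\<^sub>2)"
  proof (intro sum_mono)
    fix i assume "i \<in> S"
    then have "0 \<le> slack i - \<mu>\<^sub>2"
      using slack_on[of i] \<mu>\<^sub>2_le by (simp add: slack_def)
    then show "(slack i - \<mu>\<^sub>2) * X i \<le> slack i - \<mu>\<^sub>2"
      using assms(2)[of i] by (simp add: mult_left_le)
  qed
  finally show ?thesis by simp
qed

text \<open>No duality gap at the lift: \<open>(1, x)\<close> is in the kernel of the slack matrix,
  and the diagonal and 1-norm estimates are equalities there.\<close>

lemma objective_lift: "objective lift = optimum"
proof -
  have "pairing lift = Q 1 x"
    by (subst pairing_decomposition[where W = lift and K = "{()}" and u = "\<lambda>_. case_option 1 x"]) (auto simp: lift_def)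
  also have "\<dots> = Q 0 (\<lambda>_. 0)"
    using Q_shift[of 0 1 "\<lambda>_. 0"] by simp
  also have "\<dots> = 0" by (simp add: Q_def quad_form_on_def)
  finally have "pairing lift = 0" .
  moreover have "(\<Sum>i\<in>UNIV. slack i * (x i * x i)) = \<mu>\<^sub>2 * s + (\<Sum>i\<in>S. slack i - \<mu>\<^sub>2)"
  proof -
    have "(\<Sum>i\<in>UNIV. slack i * (x i * x i)) = (\<Sum>i\<in>S. slack i)"
      using x_on x_off by (intro sum.mono_neutral_cong_right) auto
    then show ?thesis by (simp add: sum_subtractf)
  qed
  moreover have "(\<Sum>i\<in>UNIV. \<Sum>j\<in>UNIV. subgrad i j * (x i * x j)) = \<mu>\<^sub>3 * s\<^sup>2"
  proof -
    have "(\<Sum>i\<in>UNIV. \<Sum>j\<in>UNIV. subgrad i j * (x i * x j)) = (\<Sum>i\<in>UNIV. \<Sum>j\<in>UNIV. \<mu>\<^sub>3 * ((x i * x i) * (x j * x j)))"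
      using x_off by (intro sum.cong refl) (auto simp: subgrad_def)
    also have "\<dots> = \<mu>\<^sub>3 * ((\<Sum>i\<in>UNIV. x i * x i) * (\<Sum>i\<in>UNIV. x i * x i))"
      by (simp only: flip: sum_distrib_left sum_distrib_right)
    finally show ?thesis by (simp add: sum_x sum_x2 power2_eq_square)
  qed
  ultimately show ?thesis
    by (simp add: objective_eq lift_def optimum_def)
qed

context
  fixes W :: "'d option \<Rightarrow> 'd option \<Rightarrow> real"
  assumes W_psd: "psd_on UNIV W"
    and W_None: "W None None = 1"
    and W_trace: "(\<Sum>i\<in>UNIV. W (Some i) (Some i)) = s"
    and W_abs: "(\<Sum>i\<in>UNIV. \<Sum>j\<in>UNIV. \<bar>W (Some i) (Some j)\<bar>) \<le> s\<^sup>2"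
    and W_diag: "W (Some i) (Some i) \<le> 1"
begin

text \<open>Weak duality that keeps the two nonnegative terms which must vanish at an optimal
  \<open>W\<close>.\<close>

lemma objective_ge:
  "optimum + pairing W + (\<Sum>i\<in>UNIV. \<Sum>j\<in>UNIV. \<mu>\<^sub>3 * \<bar>W (Some i) (Some j)\<bar> - subgrad i j * W (Some i) (Some j))
    \<le> objective W"
proof -
  have "\<mu>\<^sub>3 * (\<Sum>i\<in>UNIV. \<Sum>j\<in>UNIV. \<bar>W (Some i) (Some j)\<bar>) \<le> \<mu>\<^sub>3 * s\<^sup>2"
    using W_abs \<mu>\<^sub>3_nonneg by (rule mult_left_mono)
  moreover have "(\<Sum>i\<in>UNIV. slack i * W (Some i) (Some i)) \<le> \<mu>\<^sub>2 * s + (\<Sum>i\<in>S. slack i - \<mu>\<^sub>2)"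
    using W_trace W_diag by (rule sum_slack_le)
  moreover have "(\<Sum>i\<in>UNIV. \<Sum>j\<in>UNIV. \<mu>\<^sub>3 * \<bar>W (Some i) (Some j)\<bar> - subgrad i j * W (Some i) (Some j))
    = \<mu>\<^sub>3 * (\<Sum>i\<in>UNIV. \<Sum>j\<in>UNIV. \<bar>W (Some i) (Some j)\<bar>)
      - (\<Sum>i\<in>UNIV. \<Sum>j\<in>UNIV. subgrad i j * W (Some i) (Some j))"
    by (simp only: sum_subtractf sum_distrib_left)
  ultimately show ?thesis
    unfolding objective_eq[of W, OF W_None] optimum_def by linarith
qed

lemma subgrad_gap_nonneg:
  "0 \<le> \<mu>\<^sub>3 * \<bar>W (Some i) (Some j)\<bar> - subgrad i j * W (Some i) (Some j)"
proof -
  have "subgrad i j * W (Some i) (Some j) \<le> \<bar>subgrad i j\<bar> * \<bar>W (Some i) (Some j)\<bar>"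
    by (metis abs_ge_self abs_mult)
  also have "\<dots> \<le> \<mu>\<^sub>3 * \<bar>W (Some i) (Some j)\<bar>"
    by (intro mult_right_mono abs_subgrad_le) simp
  finally show ?thesis by simp
qed

lemma pairing_nonneg: "0 \<le> pairing W"
proof -
  obtain u :: "'d option \<Rightarrow> 'd option \<Rightarrow> real" where u: "\<forall>i j. W i j = (\<Sum>k\<in>UNIV. u k i * u k j)"
    using psd_on_decomposition[OF finite W_psd] by blast
  show ?thesis
    unfolding pairing_decomposition[of W, OF u[rule_format]] by (intro sum_nonneg Q_nonneg)
qed

lemma optimum_le: "optimum \<le> objective W"
proof -
  have "0 \<le> (\<Sum>i\<in>UNIV. \<Sum>j\<in>UNIV. \<mu>\<^sub>3 * \<bar>W (Some i) (Some j)\<bar> - subgrad i j * W (Some i) (Some j))"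
    by (intro sum_nonneg subgrad_gap_nonneg)
  then show ?thesis using objective_ge pairing_nonneg by linarith
qed

lemma optimal_unique:
  assumes "objective W \<le> optimum"
  shows "W = lift"
proof -
  let ?gap = "\<lambda>i j. \<mu>\<^sub>3 * \<bar>W (Some i) (Some j)\<bar> - subgrad i j * W (Some i) (Some j)"
  have "0 \<le> (\<Sum>i\<in>UNIV. \<Sum>j\<in>UNIV. ?gap i j)"
    by (intro sum_nonneg subgrad_gap_nonneg)
  then have pairing_0: "pairing W = 0" and "(\<Sum>i\<in>UNIV. \<Sum>j\<in>UNIV. ?gap i j) = 0"
    using objective_ge pairing_nonneg assms by linarith+
  then have "\<And>i. (\<Sum>j\<in>UNIV. ?gap i j) = 0"
    by (subst (asm) sum_nonneg_eq_0_iff) (auto intro: sum_nonneg subgrad_gap_nonneg)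
  then have gap_0: "?gap i j = 0" for i j
    by (metis (mono_tags, lifting) UNIV_I finite subgrad_gap_nonneg sum_nonneg_eq_0_iff)
  obtain u :: "'d option \<Rightarrow> 'd option \<Rightarrow> real" where "\<forall>i j. W i j = (\<Sum>k\<in>UNIV. u k i * u k j)"
    using psd_on_decomposition[OF finite W_psd] by blast
  then have u: "W i j = (\<Sum>k\<in>UNIV. u k i * u k j)" for i j by blast
  have "(\<Sum>k\<in>UNIV. Q (u k None) (\<lambda>i. u k (Some i))) = 0"
    using pairing_0 pairing_decomposition[of W, OF u] by simp
  then have Q_0: "Q (u k None) (\<lambda>i. u k (Some i)) = 0" for k
    by (subst (asm) sum_nonneg_eq_0_iff) (auto intro: Q_nonneg)
  have off: "u k (Some i) = 0" if "i \<notin> S" for i k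
    using strict
  proof
    assume "pd_on (- S) \<Theta>\<^sub>1"
    moreover have "\<not> 0 < quad_form_on (- S) \<Theta>\<^sub>1 (\<lambda>i. u k (Some i))"
      using Q_ge_Theta1[of "\<lambda>i. u k (Some i)" "u k None"] Q_0[of k] by simp
    ultimately show ?thesis using that by (auto simp: pd_on_def)
  next
    assume "\<forall>i\<in>- S. \<forall>j\<in>- S. \<bar>\<Theta>\<^sub>2 i j\<bar> < \<mu>\<^sub>3"
    then have "\<bar>\<Theta>\<^sub>2 i i\<bar> < \<mu>\<^sub>3" using that by simp
    \<comment> \<open>A strict bound on \<open>\<Theta>\<^sub>2\<close> makes the vanishing gap at
      \<open>(i, i)\<close> force a zero diagonal entry, which is a sum of squares of the
      \<open>u k (Some i)\<close>.\<close>
    moreover have "\<mu>\<^sub>3 * \<bar>W (Some i) (Some i)\<bar> = - \<Theta>\<^sub>2 i i * W (Some i) (Some i)"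
      using gap_0[of i i] that by (simp add: subgrad_def)
    moreover have "- \<Theta>\<^sub>2 i i * W (Some i) (Some i) \<le> \<bar>\<Theta>\<^sub>2 i i\<bar> * \<bar>W (Some i) (Some i)\<bar>"
      by (metis abs_ge_self abs_minus_cancel abs_mult)
    ultimately have "W (Some i) (Some i) = 0"
      by (smt (verit) mult_strict_right_mono zero_less_abs_iff)
    then have "(\<Sum>k\<in>UNIV. u k (Some i) * u k (Some i)) = 0" using u by simp
    then show ?thesis by (subst (asm) sum_nonneg_eq_0_iff) auto
  qed
  have "u k (Some i) = u k None * x i" for k i
    using Q_eq_0[OF Q_0 off] .
  then have "u k i = u k None * case_option 1 x i" for k i
    by (cases i) auto
  then have "W i j = (\<Sum>k\<in>UNIV. u k None * u k None) * lift i j" for i j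
    unfolding u lift_def sum_distrib_right
    by (intro sum.cong refl) (metis (no_types, opaque_lifting) mult.assoc mult.left_commute)
  \<comment> \<open>All the vectors are multiples of \<open>(1, x)\<close>; the corner entry of
    \<open>W\<close> fixes the total weight.\<close>
  moreover have "(\<Sum>k\<in>UNIV. u k None * u k None) = 1" using u W_None by metis
  ultimately show ?thesis by (simp add: fun_eq_iff)
qed

end

end

subsection \<open>The semidefinite relaxation\<close>

text \<open>Block expansion of the trace; symmetry of \<open>W\<close> merges the two cross terms,
  and the corner contributes a constant.\<close>

lemma sdp_objective_eq:
  fixes M :: "real ^ 'd ^ 'n::finite" and W :: "real ^ ('d::finite option) ^ ('d option)"
  assumes "psd_on UNIV (\<lambda>i j. W $ i $ j)" and "W $ None $ None = 1"
  shows "sdp_objective M b W = (b \<bullet> b) / real CARD('n)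
    + (2 * (\<Sum>i\<in>UNIV. y_star M b $ i * W $ None $ Some i)
       + (\<Sum>i\<in>UNIV. \<Sum>j\<in>UNIV. gram M i j * W $ Some i $ Some j))"
proof -
  define B where "B = transpose (aug_matrix M b) ** aug_matrix M b"
  have sym: "W $ i $ j = W $ j $ i" for i j
    using assms(1) by (auto simp: psd_on_def symmetric_on_def)
  have B: "B $ None $ None = b \<bullet> b"
    "B $ None $ Some j = real CARD('n) * y_star M b $ j"
    "B $ Some j $ None = real CARD('n) * y_star M b $ j"
    "B $ Some i $ Some j = real CARD('n) * gram M i j" for i j
    by (simp_all add: B_def matrix_matrix_mult_def matrix_vector_mult_def transpose_def
        aug_matrix_def y_star_def gram_def inner_vec_def sum_negf mult.commute)
  have "sdp_objective M b W = 1 / real CARD('n) * (\<Sum>i\<in>UNIV. \<Sum>j\<in>UNIV. B $ i $ j * W $ i $ j)"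
    unfolding sdp_objective_def B_def[symmetric]
    using sym by (simp add: trace_def matrix_matrix_mult_def)
  also have "(\<Sum>i\<in>UNIV. \<Sum>j\<in>UNIV. B $ i $ j * W $ i $ j) = b \<bullet> b
      + real CARD('n) * (2 * (\<Sum>i\<in>UNIV. y_star M b $ i * W $ None $ Some i)
       + (\<Sum>i\<in>UNIV. \<Sum>j\<in>UNIV. gram M i j * W $ Some i $ Some j))"
    by (simp add: sum_UNIV_option B sum.distrib sym[of "Some i" None for i] assms(2) mult.assoc
        distrib_left flip: sum_distrib_left)
  finally show ?thesis by (simp add: field_simps)
qed

lemma sdp_feasible_rank_one_lift:
  assumes "ternary x" and "card (supp x) = \<sigma>"
  shows "sdp_feasible \<sigma> (rank_one_lift x)"
proof -
  have x2: "x $ i * x $ i = (if i \<in> supp x then 1 else 0)"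
    and x1: "\<bar>x $ i\<bar> = (if i \<in> supp x then 1 else 0)" for i
    using assms(1) by (auto simp: ternary_def supp_def dest: spec[of _ i])
  have "quad_form_on UNIV (\<lambda>i j. rank_one_lift x $ i $ j) v = (\<Sum>i\<in>UNIV. homogenize x $ i * v i)\<^sup>2" for v
    unfolding quad_form_on_def power2_eq_square sum_product
    by (intro sum.cong) (auto simp: rank_one_lift_def)
  then have "psd_on UNIV (\<lambda>i j. rank_one_lift x $ i $ j)"
    by (simp add: psd_on_def symmetric_on_def rank_one_lift_def)
  moreover have "(\<Sum>i\<in>UNIV. \<Sum>j\<in>UNIV. \<bar>x $ i * x $ j\<bar>) = (\<Sum>i\<in>UNIV. \<bar>x $ i\<bar>)\<^sup>2"
    by (simp only: power2_eq_square sum_product abs_mult)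
  ultimately show ?thesis
    using assms(2) by (simp add: sdp_feasible_def lower_block_def rank_one_lift_def homogenize_def
        trace_def x1 x2 sum.If_cases)
qed

theorem theorem3:
  fixes M :: "real ^ 'd::finite ^ 'n::finite" and b :: "real ^ 'n"
    and \<sigma> :: nat and x :: "real ^ 'd"
  assumes "0 < \<sigma>" and "\<sigma> \<le> CARD('d)"
    and "ternary x" and "card (supp x) = \<sigma>"
    and "Y11_star M b x > 0"
    and "\<exists>\<delta>>0.
      vec_max_norm_on (- supp x)
        (\<lambda>i. 1 / (real CARD('n) * real \<sigma>) * (\<Sum>j\<in>supp x. (transpose M ** M) $ i $ j * x $ j)
             + 1 / real \<sigma> * y_star M b $ i)
        \<le> mu3_star M b \<sigma> x \<delta> \<and>
      (\<exists>\<mu>\<^sub>2 \<Theta>\<^sub>1 \<Theta>\<^sub>2.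
        \<mu>\<^sub>2 \<le> - lambda_min_on (supp x) (gram M) + \<delta> \<and>
        (\<forall>i\<in>- supp x. \<forall>j\<in>- supp x. Theta M b \<sigma> x \<delta> \<mu>\<^sub>2 i j = \<Theta>\<^sub>1 i j + \<Theta>\<^sub>2 i j) \<and>
        (pd_on (- supp x) \<Theta>\<^sub>1 \<and>
           mat_max_norm_on (- supp x) (- supp x) \<Theta>\<^sub>2 \<le> mu3_star M b \<sigma> x \<delta> \<or>
         psd_on (- supp x) \<Theta>\<^sub>1 \<and>
           mat_max_norm_on (- supp x) (- supp x) \<Theta>\<^sub>2 < mu3_star M b \<sigma> x \<delta>))"
  shows "sdp_recovers M b \<sigma> x"
proof -
  let ?S = "supp x" and ?n = "real CARD('n)"
  from assms(6) obtain \<delta> \<mu>\<^sub>2 \<Theta>\<^sub>1 \<Theta>\<^sub>2 where "\<delta> > 0"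
    and A1: "vec_max_norm_on (- ?S)
        (\<lambda>i. 1 / (?n * real \<sigma>) * (\<Sum>j\<in>?S. (transpose M ** M) $ i $ j * x $ j)
             + 1 / real \<sigma> * y_star M b $ i) \<le> mu3_star M b \<sigma> x \<delta>"
    and \<mu>\<^sub>2: "\<mu>\<^sub>2 \<le> - lambda_min_on ?S (gram M) + \<delta>"
    and \<Theta>: "\<And>i j. i \<in> - ?S \<Longrightarrow> j \<in> - ?S \<Longrightarrow> Theta M b \<sigma> x \<delta> \<mu>\<^sub>2 i j = \<Theta>\<^sub>1 i j + \<Theta>\<^sub>2 i j"
    and A2: "pd_on (- ?S) \<Theta>\<^sub>1 \<and> mat_max_norm_on (- ?S) (- ?S) \<Theta>\<^sub>2 \<le> mu3_star M b \<sigma> x \<delta> \<or>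
      psd_on (- ?S) \<Theta>\<^sub>1 \<and> mat_max_norm_on (- ?S) (- ?S) \<Theta>\<^sub>2 < mu3_star M b \<sigma> x \<delta>"
    by blast
  define \<mu>\<^sub>3 where "\<mu>\<^sub>3 = mu3_star M b \<sigma> x \<delta>"
  define q where "q = (\<lambda>i. (- y_star M b $ i - (\<Sum>j\<in>?S. gram M i j * x $ j)) / x $ i)"
  have ne: "?S \<noteq> {}" using assms(1,4) by auto
  have gram_sym: "gram M i j = gram M j i" for i j
    by (simp add: gram_def matrix_matrix_mult_def transpose_def mult.commute)
  have res: "\<bar>y_star M b $ i + (\<Sum>j\<in>?S. gram M i j * x $ j)\<bar> \<le> real \<sigma> * \<mu>\<^sub>3" if "i \<notin> ?S" for i
  proof -
    have "\<bar>1 / (?n * real \<sigma>) * (\<Sum>j\<in>?S. (transpose M ** M) $ i $ j * x $ j)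
             + 1 / real \<sigma> * y_star M b $ i\<bar> \<le> \<mu>\<^sub>3"
      using A1 that unfolding vec_max_norm_on_def \<mu>\<^sub>3_def by simp
    moreover have "1 / (?n * real \<sigma>) * (\<Sum>j\<in>?S. (transpose M ** M) $ i $ j * x $ j)
             + 1 / real \<sigma> * y_star M b $ i
        = (y_star M b $ i + (\<Sum>j\<in>?S. gram M i j * x $ j)) / real \<sigma>"
      by (simp add: gram_def sum_divide_distrib add_divide_distrib)
    ultimately show ?thesis
      using assms(1) by (simp add: abs_divide pos_divide_le_eq mult.commute)
  qed
  \<comment> \<open>The norm in (A1) is nonnegative even for full support, since \<open>0\<close> is
    inserted under \<open>Max\<close>.\<close>
  have "0 \<le> \<mu>\<^sub>3"
    using A1 unfolding vec_max_norm_on_def \<mu>\<^sub>3_def by simp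
  have slack: "\<delta> - lambda_min_on ?S (gram M) \<le> q i - real \<sigma> * \<mu>\<^sub>3" if "i \<in> ?S" for i
  proof -
    have "Min (q ` ?S) \<le> q i" using that by simp
    \<comment> \<open>Clearing the factor \<open>1 / \<sigma>\<close> makes the minimum in
      \<open>\<mu>\<^sub>3\<close> a lower bound for each \<open>q i\<close>.\<close>
    moreover have "real \<sigma> * \<mu>\<^sub>3 = lambda_min_on ?S (gram M) - \<delta> + Min (q ` ?S)"
      using assms(1) by (simp add: \<mu>\<^sub>3_def mu3_star_def q_def)
    ultimately show ?thesis by simp
  qed
  have \<Theta>\<^sub>2_norm: "\<bar>\<Theta>\<^sub>2 i j\<bar> \<le> mat_max_norm_on (- ?S) (- ?S) \<Theta>\<^sub>2" if "i \<notin> ?S" "j \<notin> ?S" for i j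
    unfolding mat_max_norm_on_def using that by (intro Max_ge) auto
  interpret dual_certificate "gram M" "\<lambda>i. y_star M b $ i" "\<lambda>i. x $ i" ?S "Y11_star M b x" \<delta>
    "lambda_min_on ?S (gram M)" \<mu>\<^sub>2 \<mu>\<^sub>3 \<Theta>\<^sub>1 \<Theta>\<^sub>2
  proof unfold_locales
    show "x $ i * x $ i = 1" if "i \<in> ?S" for i
      using that assms(3) by (auto simp: ternary_def supp_def dest: spec[of _ i])
    show "lambda_min_on ?S (gram M) * (\<Sum>i\<in>?S. (v i)\<^sup>2) \<le> quad_form_on ?S (gram M) v" for v
      using ne gram_sym by (intro lambda_min_on_le_quad_form) (auto simp: symmetric_on_def)
    show "\<delta> - lambda_min_on ?S (gram M)
      \<le> (- y_star M b $ i - (\<Sum>j\<in>?S. gram M i j * x $ j)) / x $ i - real (card ?S) * \<mu>\<^sub>3"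
      if "i \<in> ?S" for i
      using slack[OF that] by (simp add: q_def assms(4))
    show "psd_on (- ?S) \<Theta>\<^sub>1" using A2 pd_on_imp_psd_on by auto
    show "\<bar>\<Theta>\<^sub>2 i j\<bar> \<le> \<mu>\<^sub>3" if "i \<notin> ?S" "j \<notin> ?S" for i j
      using A2 \<Theta>\<^sub>2_norm[OF that] unfolding \<mu>\<^sub>3_def by linarith
    show "pd_on (- ?S) \<Theta>\<^sub>1 \<or> (\<forall>i\<in>- ?S. \<forall>j\<in>- ?S. \<bar>\<Theta>\<^sub>2 i j\<bar> < \<mu>\<^sub>3)"
      using A2 \<Theta>\<^sub>2_norm unfolding \<mu>\<^sub>3_def by (meson ComplD le_less_trans)
    show "gram M i j + \<mu>\<^sub>2 * (if i = j then 1 else 0) - 1 / Y11_star M b x * (y_star M b $ i * y_star M b $ j)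
      - (\<Sum>k\<in>?S. \<Sum>l\<in>?S. (gram M i k - 1 / Y11_star M b x * (y_star M b $ i * y_star M b $ k))
          * (1 / \<delta> * ((if k = l then 1 else 0) - 1 / real (card ?S) * (x $ k * x $ l)))
          * (gram M j l - 1 / Y11_star M b x * (y_star M b $ j * y_star M b $ l)))
      = \<Theta>\<^sub>1 i j + \<Theta>\<^sub>2 i j" if "i \<notin> ?S" "j \<notin> ?S" for i j
      using \<Theta>[of i j] that unfolding Theta_def R_block_def assms(4) by simp
    show "\<bar>y_star M b $ i + (\<Sum>j\<in>?S. gram M i j * x $ j)\<bar> \<le> real (card ?S) * \<mu>\<^sub>3" if "i \<notin> ?S" for i
      using res[OF that] by (simp add: assms(4))
    show "gram M i j = gram M j i" for i j by (rule gram_sym)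
    show "x $ i = 0" if "i \<notin> ?S" for i using that by (simp add: supp_def)
    show "\<mu>\<^sub>2 \<le> \<delta> - lambda_min_on ?S (gram M)" using \<mu>\<^sub>2 by simp
  qed (fact \<open>0 < \<delta>\<close> \<open>0 \<le> \<mu>\<^sub>3\<close> assms(5) ne Y11_star_def)+
  have lift_eq: "lift i j = rank_one_lift x $ i $ j" for i j
    by (simp add: lift_def rank_one_lift_def homogenize_def)
  have feas: "sdp_feasible \<sigma> (rank_one_lift x)"
    using assms(3,4) by (rule sdp_feasible_rank_one_lift)
  have obj: "sdp_objective M b W = (b \<bullet> b) / ?n + objective (\<lambda>i j. W $ i $ j)"
    if "sdp_feasible \<sigma> W" for W
    using that sdp_objective_eq[of W M b] by (simp add: sdp_feasible_def objective_def)
  have opt: "objective (\<lambda>i j. rank_one_lift x $ i $ j) = optimum"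
    using objective_lift by (simp flip: lift_eq)
  have ge: "optimum \<le> objective (\<lambda>i j. W $ i $ j)"
    and uniq: "objective (\<lambda>i j. W $ i $ j) \<le> optimum \<Longrightarrow> W = rank_one_lift x"
    if "sdp_feasible \<sigma> W" for W
  proof -
    have W: "psd_on UNIV (\<lambda>i j. W $ i $ j)" "W $ None $ None = 1"
      "(\<Sum>i\<in>UNIV. W $ Some i $ Some i) = real (card ?S)"
      "(\<Sum>i\<in>UNIV. \<Sum>j\<in>UNIV. \<bar>W $ Some i $ Some j\<bar>) \<le> (real (card ?S))\<^sup>2"
      "\<And>i. W $ Some i $ Some i \<le> 1"
      using that by (auto simp: sdp_feasible_def lower_block_def trace_def assms(4))
    show "optimum \<le> objective (\<lambda>i j. W $ i $ j)"
      using W by (rule optimum_le)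
    show "W = rank_one_lift x" if "objective (\<lambda>i j. W $ i $ j) \<le> optimum"
    proof -
      have "(\<lambda>i j. W $ i $ j) = lift"
        using W that by (rule optimal_unique)
      then show ?thesis by (simp add: fun_eq_iff vec_eq_iff lift_eq)
    qed
  qed
  have "sdp_optimal M b \<sigma> (rank_one_lift x)"
    using feas ge by (auto simp: sdp_optimal_def obj opt)
  moreover have "W = rank_one_lift x" if "sdp_optimal M b \<sigma> W" for W
  proof -
    have "sdp_feasible \<sigma> W" and "sdp_objective M b W \<le> sdp_objective M b (rank_one_lift x)"
      using that feas by (auto simp: sdp_optimal_def)
    then show ?thesis using feas by (intro uniq) (simp_all add: obj opt)
  qed
  ultimately show ?thesis
    using assms(3) unfolding sdp_recovers_def by blast
qed

end
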